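(* Let $G$ be a connected quantum graph with vertex set $V$, edge set $E$ and edge lengths $(L_e)_{e\in E}$, let $\emptyset\neq V_{\mathrm o}\subseteq V$ be the set of outer vertices, $V_{\mathrm i}=V\setminus V_{\mathrm o}$, and let $G_{\mathrm o}=(V_{\mathrm o},E_{\mathrm o})$ be the reduced graph of $G$ associated with $V_{\mathrm o}$. Let $\lambda\in\mathbb C\setminus\sigma(-\Delta_{V_{\mathrm o}})$. Then the following assertions hold. (i) $D_{\lambda,V_{\mathrm o}}\in\mathcal A(G_{\mathrm o})$. (ii) Enumerate the vertices such that $V=\{v_k\colon k=1,\dots,n\}$ and $V_{\mathrm o}=\{v_k\colon k=1,\dots,m\}$. Suppose that $m<n$ and that $\lambda\notin\sigma(-\Delta_V)$ (so that $D_{\lambda,V}$ is defined), and write $$-D_{\lambda,V}=\begin{bmatrix} A & B^T \\ B & C \end{bmatrix},$$ where $A\in\mathbb C^{m\times m}$ corresponds to the first $m$ vertices $v_1,\dots,v_m$ (that is, to $V_{\mathrm o}$), $B\in\mathbb C^{(n-m)\times m}$, $B^T\in\mathbb C^{m\times(n-m)}$ is the transpose of $B$, and $C\in\mathbb C^{(n-m)\times(n-m)}$. Then $C$ is invertible and $-D_{\lambda,V_{\mathrm o}}$ is given by the Schur complement of $C$, that is, $$-D_{\lambda,V_{\mathrm o}}=A+B^T(-C)^{-1}B.$$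
   Context: Quantum graph. $G=(V,E)$ is a finite connected simple undirected graph (no loops, no parallel edges) with $E\neq\emptyset$, together with a length $L_e\in(0,\infty)$ for each $e\in E$. Each edge $e$ is identified with the interval $[0,L_e]$, one endpoint $e_{\mathrm l}$ of $e$ being identified with $0$ and the other endpoint $e_{\mathrm r}$ with $L_e$ (the choice of orientation is irrelevant). Functions are complex valued. $L^2(G)=\bigoplus_{e\in E}L^2([0,L_e])$. Maximal Laplacian. $D(\Delta_{\max})$ is the set of all $f=(f_e)_{e\in E}$ with $f_e\in H^2([0,L_e])$ for all $e$ that are continuous across vertices, i.e. $f_e(v)=f_{\tilde e}(v)$ whenever $e,\tilde e\in E$ both meet $v\in V$; $\Delta_{\max}f:=(f_e'')_{e\in E}$. The trace $\gamma f\in\mathbb C^V$ is $(\gamma f)(v):=$ the common value of $f$ at $v$. The outer normal derivative $\nu f\in\mathbb C^V$ is $(\nu f)(v):=-\sum_{e:\,e_{\mathrm l}=v}f_e'(0)+\sum_{e:\,e_{\mathrm r}=v}f_e'(L_e)$. Laplacian $\Delta_{V_{\mathrm o}}$. For $\emptyset\neq V_{\mathrm o}\subseteq V$ and $V_{\mathrm i}=V\setminus V_{\mathrm o}$, $\Delta_{V_{\mathrm o}}$ is the restriction of $\Delta_{\max}$ to $\{f\in D(\Delta_{\max})\colon(\gamma f)|_{V_{\mathrm o}}=0,\ (\nu f)|_{V_{\mathrm i}}=0\}$, an operator on $L^2(G)$; $-\Delta_{V_{\mathrm o}}$ is self-adjoint with compact resolvent and spectrum $\sigma(-\Delta_{V_{\mathrm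 o}})\subseteq(0,\infty)$. The case $V_{\mathrm o}=V$ is written $\Delta_V$. Dirichlet-to-Neumann operator. For $\lambda\in\mathbb C\setminus\sigma(-\Delta_{V_{\mathrm o}})$ and $x\in\mathbb C^{V_{\mathrm o}}$ there is a unique $f\in D(\Delta_{\max})$ with $\Delta_{\max}f+\lambda f=0$, $(\gamma f)|_{V_{\mathrm o}}=x$, $(\nu f)|_{V_{\mathrm i}}=0$; one sets $D_{\lambda,V_{\mathrm o}}x:=(\nu f)|_{V_{\mathrm o}}$. $D_{\lambda,V_{\mathrm o}}\colon\mathbb C^{V_{\mathrm o}}\to\mathbb C^{V_{\mathrm o}}$ is identified with its matrix in the standard basis. $D_{\lambda,V}$ is the case $V_{\mathrm o}=V$. Reduced graph. $G_{\mathrm o}=(V_{\mathrm o},E_{\mathrm o})$ is the simple graph with vertex set $V_{\mathrm o}$ in which distinct $v,w\in V_{\mathrm o}$ are joined by a single edge if and only if there is an edge of $G$ between them or there is a path in $G$ from $v$ to $w$ all of whose intermediate vertices (at least one) lie in $V_{\mathrm i}$. The class $\mathcal A(H)$. For a graph $H$ with vertices $v_1,\dots,v_N$, the edge between $v_k$ and $v_j$ being identified with $(k,j)$, a matrix $Q\in\mathbb C^{N\times N}$ belongs to $\mathcal A(H)$ if $Q_{kj}=0$ whenever $k\neq j$ and $(k,j)$ is not an edge of $H$. *)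

theory Defs
  imports
    "HOL-Analysis.Analysis"
    "Jordan_Normal_Form.Gauss_Jordan_Elimination"
begin

section \<open>Quantum graphs\<close>

text \<open>Edges are two-element sets of vertices, so parallel edges and loops are excluded.
  The edge \<open>e\<close> is identified with the interval \<open>[0, len G e]\<close> such that
  \<open>eleft G e\<close> corresponds to \<open>0\<close> and \<open>eright G e\<close> to \<open>len G e\<close>.\<close>

record 'v quantum_graph =
  verts :: "'v set"
  edges :: "'v set set"
  len :: "'v set \<Rightarrow> real"
  eleft :: "'v set \<Rightarrow> 'v"
  eright :: "'v set \<Rightarrow> 'v"

definition is_path :: "'v quantum_graph \<Rightarrow> 'v list \<Rightarrow> bool" where
  "is_path G p \<longleftrightarrow> p \<noteq> [] \<and> distinct p \<and> set p \<subseteq> verts G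
     \<and> successively (\<lambda>v w. {v, w} \<in> edges G) p"

definition path_between :: "'v quantum_graph \<Rightarrow> 'v \<Rightarrow> 'v list \<Rightarrow> 'v \<Rightarrow> bool" where
  "path_between G v p w \<longleftrightarrow> is_path G p \<and> hd p = v \<and> last p = w"

definition connected_quantum_graph :: "'v quantum_graph \<Rightarrow> bool" where
  "connected_quantum_graph G \<longleftrightarrow>
     finite (verts G) \<and> edges G \<noteq> {} \<and>
     (\<forall>e\<in>edges G. e \<subseteq> verts G \<and> e = {eleft G e, eright G e} \<and> eleft G e \<noteq> eright G e
        \<and> 0 < len G e) \<and>
     (\<forall>v\<in>verts G. \<forall>w\<in>verts G. \<exists>p. path_between G v p w)"

text \<open>In the second alternative, \<open>butlast (tl p)\<close> lists the intermediate vertices of \<open>p\<close>.\<close>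

definition reduced_edges :: "'v quantum_graph \<Rightarrow> 'v set \<Rightarrow> 'v set set" where
  "reduced_edges G Vo = {{v, w} | v w. v \<in> Vo \<and> w \<in> Vo \<and> v \<noteq> w \<and>
     ({v, w} \<in> edges G \<or>
      (\<exists>p. path_between G v p w \<and> butlast (tl p) \<noteq> [] \<and>
           set (butlast (tl p)) \<subseteq> verts G - Vo))}"

section \<open>Function spaces\<close>

definition L2_interval :: "real \<Rightarrow> (real \<Rightarrow> complex) set" where
  "L2_interval l = {f \<in> borel_measurable (lebesgue_on {0..l}).
     integrable (lebesgue_on {0..l}) (\<lambda>x. (cmod (f x))\<^sup>2)}"

text \<open>One-sided at the end points \<open>0\<close> and \<open>l\<close>.\<close>

definition deriv_on :: "real \<Rightarrow> (real \<Rightarrow> complex) \<Rightarrow> real \<Rightarrow> complex" where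
  "deriv_on l f x = vector_derivative f (at x within {0..l})"

text \<open>\<open>H2_interval l f h\<close> says that \<open>f\<close> is (the continuously differentiable representative of)
  an element of the Sobolev space $H^2([0,l])$, and that \<open>h\<close> represents its second weak
  derivative: \<open>f\<close> is differentiable on \<open>[0,l]\<close>, and \<open>f'\<close> is absolutely continuous with
  derivative \<open>h\<close> in $L^2$. The function \<open>h\<close> is determined almost everywhere only.\<close>

definition H2_interval :: "real \<Rightarrow> (real \<Rightarrow> complex) \<Rightarrow> (real \<Rightarrow> complex) \<Rightarrow> bool" where
  "H2_interval l f h \<longleftrightarrow>
     f differentiable_on {0..l} \<and> h \<in> L2_interval l \<and>
     (\<forall>x\<in>{0..l}. deriv_on l f x = deriv_on l f 0 + (LINT t|lebesgue_on {0..x}. h t))"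

text \<open>A function on \<open>G\<close> is a family \<open>f\<close> indexed by the edges. Elements of $L^2(G)$ are
  given by representatives, and \<open>L2_eq G\<close> is equality in $L^2(G)$; the values of \<open>f e x\<close>
  for \<open>e\<close> not an edge or \<open>x\<close> outside \<open>[0, len G e]\<close> never matter.\<close>

type_synonym 'v gfun = "'v set \<Rightarrow> real \<Rightarrow> complex"

definition L2_graph :: "'v quantum_graph \<Rightarrow> 'v gfun set" where
  "L2_graph G = {f. \<forall>e\<in>edges G. f e \<in> L2_interval (len G e)}"

definition L2_eq :: "'v quantum_graph \<Rightarrow> 'v gfun \<Rightarrow> 'v gfun \<Rightarrow> bool" where
  "L2_eq G f g \<longleftrightarrow> (\<forall>e\<in>edges G. AE x in lebesgue_on {0..len G e}. f e x = g e x)"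

definition L2_norm :: "'v quantum_graph \<Rightarrow> 'v gfun \<Rightarrow> real" where
  "L2_norm G f = sqrt (\<Sum>e\<in>edges G. LINT x|lebesgue_on {0..len G e}. (cmod (f e x))\<^sup>2)"

section \<open>Operators in $L^2(G)$ and their spectrum\<close>

text \<open>An unbounded operator \<open>T\<close> in $L^2(G)$ is given by its graph, the set of pairs
  \<open>(f, T f)\<close>, where all representatives of \<open>T f\<close> are allowed as second component.\<close>

type_synonym 'v gop = "('v gfun \<times> 'v gfun) set"

definition neg_op :: "'v gop \<Rightarrow> 'v gop" where
  "neg_op T = {(f, \<lambda>e x. - g e x) | f g. (f, g) \<in> T}"

text \<open>\<open>z\<close> belongs to the resolvent set if \<open>T - z\<close> is a bijection from the domain of \<open>T\<close>
  onto $L^2(G)$ whose inverse is bounded.\<close>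

definition resolvent_set :: "'v quantum_graph \<Rightarrow> 'v gop \<Rightarrow> complex set" where
  "resolvent_set G T = {z.
     (\<forall>h\<in>L2_graph G. \<exists>(f, g)\<in>T. L2_eq G (\<lambda>e x. g e x - z * f e x) h) \<and>
     (\<forall>(f, g)\<in>T. \<forall>(f', g')\<in>T.
        L2_eq G (\<lambda>e x. g e x - z * f e x) (\<lambda>e x. g' e x - z * f' e x) \<longrightarrow> L2_eq G f f') \<and>
     (\<exists>c. \<forall>(f, g)\<in>T. L2_norm G f \<le> c * L2_norm G (\<lambda>e x. g e x - z * f e x))}"

definition op_spectrum :: "'v quantum_graph \<Rightarrow> 'v gop \<Rightarrow> complex set" where
  "op_spectrum G T = - resolvent_set G T"

section \<open>The Laplacians\<close>

text \<open>The value of \<open>f e\<close> at an end point \<open>v\<close> of \<open>e\<close>.\<close>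

definition end_value :: "'v quantum_graph \<Rightarrow> 'v gfun \<Rightarrow> 'v set \<Rightarrow> 'v \<Rightarrow> complex" where
  "end_value G f e v = f e (if v = eleft G e then 0 else len G e)"

definition Delta_max :: "'v quantum_graph \<Rightarrow> 'v gop" where
  "Delta_max G = {(f, g).
     (\<forall>e\<in>edges G. H2_interval (len G e) (f e) (g e)) \<and>
     (\<forall>v\<in>verts G. \<forall>e\<in>edges G. \<forall>e'\<in>edges G. v \<in> e \<and> v \<in> e' \<longrightarrow>
        end_value G f e v = end_value G f e' v)}"

definition gtrace :: "'v quantum_graph \<Rightarrow> 'v gfun \<Rightarrow> 'v \<Rightarrow> complex" where
  "gtrace G f v = (THE y. \<forall>e\<in>edges G. v \<in> e \<longrightarrow> end_value G f e v = y)"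

definition normal_deriv :: "'v quantum_graph \<Rightarrow> 'v gfun \<Rightarrow> 'v \<Rightarrow> complex" where
  "normal_deriv G f v =
     - (\<Sum>e | e \<in> edges G \<and> eleft G e = v. deriv_on (len G e) (f e) 0)
     + (\<Sum>e | e \<in> edges G \<and> eright G e = v. deriv_on (len G e) (f e) (len G e))"

definition Delta :: "'v quantum_graph \<Rightarrow> 'v set \<Rightarrow> 'v gop" where
  "Delta G Vo = {(f, g) \<in> Delta_max G.
     (\<forall>v\<in>Vo. gtrace G f v = 0) \<and> (\<forall>v\<in>verts G - Vo. normal_deriv G f v = 0)}"

section \<open>The Dirichlet-to-Neumann operator\<close>

definition DtN_solution ::
  "'v quantum_graph \<Rightarrow> 'v set \<Rightarrow> complex \<Rightarrow> ('v \<Rightarrow> complex) \<Rightarrow> 'v gfun \<Rightarrow> bool" where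
  "DtN_solution G Vo z x f \<longleftrightarrow>
     (\<exists>g. (f, g) \<in> Delta_max G \<and> L2_eq G (\<lambda>e t. g e t + z * f e t) (\<lambda>e t. 0)) \<and>
     (\<forall>v\<in>Vo. gtrace G f v = x v) \<and> (\<forall>v\<in>verts G - Vo. normal_deriv G f v = 0)"

text \<open>The space $\mathbb C^{V_o}$ consists of the functions on \<open>'v\<close> regarded on \<open>Vo\<close> only.
  Since a solution \<open>f\<close> is unique on the edges of \<open>G\<close> but not as a HOL function, the definite
  description is applied to the restriction of its normal derivative to \<open>Vo\<close>.\<close>

definition DtN ::
  "'v quantum_graph \<Rightarrow> 'v set \<Rightarrow> complex \<Rightarrow> ('v \<Rightarrow> complex) \<Rightarrow> ('v \<Rightarrow> complex)" where
  "DtN G Vo z x = (THE y. \<exists>f. DtN_solution G Vo z x f \<and> y = restrict (normal_deriv G f) Vo)"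

text \<open>The matrix in the standard basis, for \<open>Vo = {v 0, \<dots>, v (card Vo - 1)}\<close>.\<close>

definition DtN_mat ::
  "'v quantum_graph \<Rightarrow> 'v set \<Rightarrow> (nat \<Rightarrow> 'v) \<Rightarrow> complex \<Rightarrow> complex mat" where
  "DtN_mat G Vo v z = Matrix.mat (card Vo) (card Vo)
     (\<lambda>(k, j). DtN G Vo z (\<lambda>w. if w = v j then 1 else 0) (v k))"

text \<open>The class $\mathcal A(H)$ for a graph \<open>H\<close> with vertices \<open>v 0, \<dots>, v (N - 1)\<close> and
  edge set \<open>EH\<close>.\<close>

definition class_A :: "nat \<Rightarrow> (nat \<Rightarrow> 'v) \<Rightarrow> 'v set set \<Rightarrow> complex mat set" where
  "class_A N v EH = {Q \<in> carrier_mat N N.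
     \<forall>k<N. \<forall>j<N. k \<noteq> j \<and> {v k, v j} \<notin> EH \<longrightarrow> Q $$ (k, j) = 0}"

end

theory Submission
  imports Defs "Jordan_Normal_Form.Determinant"
begin

text \<open>Elliptic regularity on an interval is elementary: an \<open>H\<^sup>2\<close> function whose weak second derivative
  agrees almost everywhere with a continuous function has that function as classical second
  derivative. So the solutions that define the Dirichlet-to-Neumann operator are exactly the
  families \<open>f\<close> of classical solutions of \<open>f'' = - z f\<close> on the edges whose end values come from a
  function \<open>y\<close> on the vertices (\<open>helmholtz_graph G z f y\<close>) and that satisfy the trace condition on
  \<open>Vo\<close> and the Kirchhoff condition elsewhere. Off the spectrum, such an \<open>f\<close> exists for all boundary
  data (\<open>helmholtz_graph_exists\<close>): extend the data to the graph by cubic polynomials with vanishing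
  derivative at the ends and correct the error by the resolvent. It is unique, because the
  difference of two solutions lies in the kernel of \<open>\<Delta> + z\<close>
  (\<open>helmholtz_graph_unique\<close>).

  Membership in the class of the reduced graph is a statement about supports. Let \<open>s \<in> Vo\<close>, and let
  \<open>R\<close> consist of \<open>s\<close> and the inner vertices that can be reached from \<open>s\<close> through inner vertices. Take
  the solution with boundary data \<open>1\<close> at \<open>s\<close> and \<open>0\<close> elsewhere and replace it by \<open>0\<close> on all edges that
  do not meet \<open>R\<close>. The result solves the same boundary value problem, since an edge leaves \<open>R\<close> only
  at outer vertices, where the solution vanishes. An outer vertex \<open>w \<noteq> s\<close> that is not adjacent to \<open>s\<close>
  in the reduced graph has no edge to \<open>R\<close>, so the normal derivative at \<open>w\<close> is \<open>0\<close>
  (\<open>DtN_zero_off_reduced_edges\<close>).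

  For the Schur complement, the normal derivative of every solution is the matrix of the full
  operator applied to its vertex values (\<open>normal_deriv_expansion\<close>), and this matrix is symmetric
  because the Wronskian of two solutions is constant on each edge (\<open>DtN_symmetric\<close>). A vector in the
  kernel of \<open>C\<close>, extended by \<open>0\<close> to \<open>Vo\<close>, gives the vertex values of a solution of the homogeneous
  problem for \<open>Vo\<close> and is therefore \<open>0\<close>. If a solution for \<open>Vo\<close> has outer values \<open>x\<close> and inner values
  \<open>y\<close>, the Kirchhoff conditions say \<open>B x + C y = 0\<close>; solving this for \<open>y\<close> and inserting it into
  \<open>A x + B\<^sup>T y\<close> is the formula to be shown.\<close>

section \<open>Functions on one edge\<close>

lemma deriv_on_eqI:
  assumes "0 < l" "x \<in> {0..l}" "(f has_vector_derivative d) (at x within {0..l})"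
  shows "deriv_on l f x = d"
  unfolding deriv_on_def using vector_derivative_within_closed_interval assms by blast

lemma deriv_on_cong:
  assumes "x \<in> {0..l}" "\<And>t. t \<in> {0..l} \<Longrightarrow> f t = g t"
  shows "deriv_on l f x = deriv_on l g x"
proof -
  have "(f has_vector_derivative d) (at x within {0..l}) \<longleftrightarrow>
        (g has_vector_derivative d) (at x within {0..l})" for d
    using has_vector_derivative_transform[OF assms(1), of f g d]
      has_vector_derivative_transform[OF assms(1), of g f d] assms(2) by auto
  then show ?thesis
    unfolding deriv_on_def vector_derivative_def by simp
qed

lemma continuous_L2_interval:
  fixes h :: "real \<Rightarrow> complex"
  assumes "continuous_on {0..l} h"
  shows "h \<in> L2_interval l"
proof -
  have "continuous_on {0..l} (\<lambda>x. (cmod (h x))\<^sup>2)" using assms by (intro continuous_intros)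
  then show ?thesis
    unfolding L2_interval_def
    using continuous_imp_measurable_on_sets_lebesgue[OF assms] continuous_imp_integrable_real
    by simp
qed

text \<open>Only the indefinite integral of \<open>h\<close> enters the definition of \<open>H2_interval\<close>, so \<open>h\<close> may be replaced
  by \<open>c\<close>, and the fundamental theorem of calculus applies to the continuous \<open>c\<close>.\<close>

lemma H2_interval_deriv:
  assumes H: "H2_interval l f h" and ae: "AE x in lebesgue_on {0..l}. h x = c x"
    and c: "continuous_on {0..l} c" and x: "x \<in> {0..l}"
  shows "(f has_vector_derivative deriv_on l f x) (at x within {0..l})"
    and "(deriv_on l f has_vector_derivative c x) (at x within {0..l})"
proof -
  have df: "f differentiable_on {0..l}" and hL: "h \<in> L2_interval l"
    and f1: "\<And>x. x \<in> {0..l} \<Longrightarrow> deriv_on l f x = deriv_on l f 0 + (LINT t|lebesgue_on {0..x}. h t)"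
    using H unfolding H2_interval_def by blast+
  show "(f has_vector_derivative deriv_on l f x) (at x within {0..l})"
    using df x unfolding deriv_on_def differentiable_on_def
    by (simp add: vector_derivative_works)
  have hm: "h \<in> borel_measurable (lebesgue_on {0..l})"
    using hL unfolding L2_interval_def by auto
  have eq: "deriv_on l f y = deriv_on l f 0 + integral {0..y} c" if y: "y \<in> {0..l}" for y
  proof -
    have sub: "{0..y} \<subseteq> {0..l}" using y by auto
    have cy: "continuous_on {0..y} c" using c sub continuous_on_subset by blast
    have "(LINT t|lebesgue_on {0..y}. h t) = (LINT t|lebesgue_on {0..y}. c t)"
    proof (rule integral_cong_AE)
      show "h \<in> borel_measurable (lebesgue_on {0..y})"
        using hm sub measurable_restrict_mono by blast
      show "c \<in> borel_measurable (lebesgue_on {0..y})"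
        using cy by (intro continuous_imp_measurable_on_sets_lebesgue) auto
      show "AE t in lebesgue_on {0..y}. h t = c t"
        using ae sub by (auto simp: AE_restrict_space_iff elim!: eventually_mono)
    qed
    also have "\<dots> = integral {0..y} c"
      using cy by (intro lebesgue_integral_eq_integral continuous_imp_integrable_real) auto
    finally show ?thesis by (subst f1[OF y]) simp
  qed
  have "((\<lambda>y. deriv_on l f 0 + integral {0..y} c) has_vector_derivative c x) (at x within {0..l})"
    using integral_has_vector_derivative[OF c x] by (auto intro!: derivative_eq_intros)
  then show "(deriv_on l f has_vector_derivative c x) (at x within {0..l})"
    by (rule has_vector_derivative_transform[OF x, rotated]) (rule eq)
qed

lemma H2_intervalI:
  assumes l: "0 < l"
    and f: "\<And>x. x \<in> {0..l} \<Longrightarrow> (f has_vector_derivative f1 x) (at x within {0..l})"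
    and f1: "\<And>x. x \<in> {0..l} \<Longrightarrow> (f1 has_vector_derivative c x) (at x within {0..l})"
    and c: "continuous_on {0..l} c"
  shows "H2_interval l f c"
proof -
  have d: "deriv_on l f x = f1 x" if "x \<in> {0..l}" for x
    using deriv_on_eqI[OF l that f[OF that]] .
  have "f differentiable_on {0..l}"
    unfolding differentiable_on_def using f differentiableI_vector by blast
  moreover have "deriv_on l f x = deriv_on l f 0 + (LINT t|lebesgue_on {0..x}. c t)"
    if x: "x \<in> {0..l}" for x
  proof -
    have sub: "{0..x} \<subseteq> {0..l}" using x by auto
    have "(c has_integral f1 x - f1 0) {0..x}"
      using x sub f1 by (intro fundamental_theorem_of_calculus)
        (auto intro: has_vector_derivative_within_subset[OF _ sub])
    moreover have "(LINT t|lebesgue_on {0..x}. c t) = integral {0..x} c"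
      using continuous_on_subset[OF c sub]
      by (intro lebesgue_integral_eq_integral continuous_imp_integrable_real) auto
    ultimately have "(LINT t|lebesgue_on {0..x}. c t) = f1 x - f1 0" by (simp add: integral_unique)
    then show ?thesis using d[OF x] d[of 0] l by simp
  qed
  ultimately show ?thesis
    unfolding H2_interval_def using continuous_L2_interval[OF c] by blast
qed

lemma continuous_AE_zero_imp_zero:
  fixes f :: "real \<Rightarrow> complex"
  assumes l: "0 < l" and f: "continuous_on {0..l} f"
    and ae: "AE x in lebesgue_on {0..l}. f x = 0" and x: "x \<in> {0..l}"
  shows "f x = 0"
proof -
  have cn: "continuous_on {0..l} (\<lambda>x. cmod (f x))"
    using f by (intro continuous_intros)
  have "integral {0..l} (\<lambda>x. cmod (f x)) = (LINT t|lebesgue_on {0..l}. cmod (f t))"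
    using cn by (intro lebesgue_integral_eq_integral[symmetric] continuous_imp_integrable_real) auto
  also have "\<dots> = (LINT t|lebesgue_on {0..l}. 0)"
    using ae cn by (intro integral_cong_AE continuous_imp_measurable_on_sets_lebesgue) auto
  finally have "integral {0..l} (\<lambda>x. cmod (f x)) = 0" by simp
  then have "\<forall>x\<in>{0..l}. cmod (f x) = 0"
    using integral_eq_0_iff[OF cn l] by simp
  then show ?thesis using x by simp
qed

text \<open>The first conjunct expresses differentiability of \<open>f\<close>, since \<open>deriv_on\<close> has a value for every
  function.\<close>

definition helmholtz_on :: "real \<Rightarrow> complex \<Rightarrow> (real \<Rightarrow> complex) \<Rightarrow> bool" where
  "helmholtz_on l z f \<longleftrightarrow> (\<forall>x\<in>{0..l}.
     (f has_vector_derivative deriv_on l f x) (at x within {0..l}) \<and>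
     (deriv_on l f has_vector_derivative - z * f x) (at x within {0..l}))"

lemma helmholtz_on_continuous: "helmholtz_on l z f \<Longrightarrow> continuous_on {0..l} f"
  unfolding helmholtz_on_def continuous_on_eq_continuous_within
  using has_vector_derivative_continuous by blast

lemma helmholtz_onI:
  assumes l: "0 < l"
    and f: "\<And>x. x \<in> {0..l} \<Longrightarrow> (f has_vector_derivative f1 x) (at x within {0..l})"
    and f1: "\<And>x. x \<in> {0..l} \<Longrightarrow> (f1 has_vector_derivative - z * f x) (at x within {0..l})"
  shows "helmholtz_on l z f"
  unfolding helmholtz_on_def
proof (intro ballI conjI)
  fix x assume x: "x \<in> {0..l}"
  have d: "deriv_on l f x = f1 x" if "x \<in> {0..l}" for x
    using deriv_on_eqI[OF l that f[OF that]] .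
  show "(f has_vector_derivative deriv_on l f x) (at x within {0..l})" using f d x by simp
  show "(deriv_on l f has_vector_derivative - z * f x) (at x within {0..l})"
    using f1[OF x] by (rule has_vector_derivative_transform[OF x, rotated]) (use d in auto)
qed

lemma helmholtz_on_H2_interval:
  assumes l: "0 < l" and h: "helmholtz_on l z f"
  shows "H2_interval l f (\<lambda>x. - z * f x)"
proof (rule H2_intervalI[OF l, where ?f1.0 = "deriv_on l f"])
  show "continuous_on {0..l} (\<lambda>x. - z * f x)"
    using helmholtz_on_continuous[OF h] by (intro continuous_intros)
qed (use h in \<open>unfold helmholtz_on_def, blast+\<close>)

text \<open>This turns the weak equation, in which the second derivative is known almost everywhere only,
  into the classical one; all later arguments are pointwise.\<close>

lemma helmholtz_on_iff_H2:
  assumes l: "0 < l"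
  shows "helmholtz_on l z f \<longleftrightarrow>
    (\<exists>h. H2_interval l f h \<and> (AE x in lebesgue_on {0..l}. h x + z * f x = 0))"
proof
  assume h: "helmholtz_on l z f"
  from helmholtz_on_H2_interval[OF l h]
  show "\<exists>h. H2_interval l f h \<and> (AE x in lebesgue_on {0..l}. h x + z * f x = 0)"
    by (intro exI[of _ "\<lambda>x. - z * f x"]) auto
next
  assume "\<exists>h. H2_interval l f h \<and> (AE x in lebesgue_on {0..l}. h x + z * f x = 0)"
  then obtain h where H: "H2_interval l f h"
    and ae: "AE x in lebesgue_on {0..l}. h x + z * f x = 0" by blast
  have "continuous_on {0..l} f"
    using H differentiable_imp_continuous_on unfolding H2_interval_def by blast
  then have c: "continuous_on {0..l} (\<lambda>x. - z * f x)" by (intro continuous_intros)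
  have h_eq: "AE x in lebesgue_on {0..l}. h x = - z * f x"
    using ae by eventually_elim (simp add: eq_neg_iff_add_eq_0)
  show "helmholtz_on l z f"
    unfolding helmholtz_on_def
    by (intro ballI conjI H2_interval_deriv[OF H h_eq c])
qed

lemma helmholtz_on_lincomb:
  assumes l: "0 < l" and f: "helmholtz_on l z f" and g: "helmholtz_on l z g"
  shows "helmholtz_on l z (\<lambda>t. a * f t + b * g t)"
    and "x \<in> {0..l} \<Longrightarrow>
      deriv_on l (\<lambda>t. a * f t + b * g t) x = a * deriv_on l f x + b * deriv_on l g x"
proof -
  have d: "((\<lambda>t. a * f t + b * g t) has_vector_derivative a * deriv_on l f x + b * deriv_on l g x)
      (at x within {0..l})" if "x \<in> {0..l}" for x
    using f g that unfolding helmholtz_on_def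
    by (intro has_vector_derivative_add has_vector_derivative_mult_right) simp_all
  show "x \<in> {0..l} \<Longrightarrow>
      deriv_on l (\<lambda>t. a * f t + b * g t) x = a * deriv_on l f x + b * deriv_on l g x"
    using deriv_on_eqI[OF l _ d] by blast
  show "helmholtz_on l z (\<lambda>t. a * f t + b * g t)"
  proof (rule helmholtz_onI[OF l d])
    fix x assume x: "x \<in> {0..l}"
    have "((\<lambda>x. a * deriv_on l f x + b * deriv_on l g x) has_vector_derivative
        a * (- z * f x) + b * (- z * g x)) (at x within {0..l})"
      using f g x unfolding helmholtz_on_def
      by (intro has_vector_derivative_add has_vector_derivative_mult_right) simp_all
    then show "((\<lambda>x. a * deriv_on l f x + b * deriv_on l g x) has_vector_derivative
        - z * (a * f x + b * g x)) (at x within {0..l})"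
      by (simp add: algebra_simps)
  qed
qed

text \<open>The derivative of \<open>f' g - f g'\<close> is \<open>- z f g + z f g = 0\<close>.\<close>

lemma wronskian_constant:
  assumes l: "0 < l" and f: "helmholtz_on l z f" and g: "helmholtz_on l z g"
  shows "deriv_on l f l * g l - f l * deriv_on l g l = deriv_on l f 0 * g 0 - f 0 * deriv_on l g 0"
proof -
  let ?W = "\<lambda>x. deriv_on l f x * g x - f x * deriv_on l g x"
  have W: "(?W has_vector_derivative 0) (at x within {0..l})" if x: "x \<in> {0..l}" for x
  proof -
    have "(?W has_vector_derivative
       (deriv_on l f x * deriv_on l g x + (- z * f x) * g x) -
       (f x * (- z * g x) + deriv_on l f x * deriv_on l g x)) (at x within {0..l})"
      using f g x unfolding helmholtz_on_def
      by (intro has_vector_derivative_diff has_vector_derivative_mult) simp_all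
    then show ?thesis by (simp add: algebra_simps)
  qed
  obtain c where "\<And>x. x \<in> {0..l} \<Longrightarrow> ?W x = c"
    using has_vector_derivative_zero_constant[of "{0..l}" ?W] W by auto
  from this[of 0] this[of l] l show ?thesis by auto
qed

section \<open>Helmholtz functions on the graph\<close>

text \<open>Continuity across vertices in the form that is stable under linear combinations and under cutting
  off: the end values are given by one function on the vertices.\<close>

definition vertex_values :: "'v quantum_graph \<Rightarrow> 'v gfun \<Rightarrow> ('v \<Rightarrow> complex) \<Rightarrow> bool" where
  "vertex_values G f y \<longleftrightarrow>
     (\<forall>e\<in>edges G. f e 0 = y (eleft G e) \<and> f e (len G e) = y (eright G e))"

definition helmholtz_graph ::
  "'v quantum_graph \<Rightarrow> complex \<Rightarrow> 'v gfun \<Rightarrow> ('v \<Rightarrow> complex) \<Rightarrow> bool" where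
  "helmholtz_graph G z f y \<longleftrightarrow>
     (\<forall>e\<in>edges G. helmholtz_on (len G e) z (f e)) \<and> vertex_values G f y"

lemma normal_deriv_cong:
  assumes "\<And>e. e \<in> edges G \<Longrightarrow> e = {eleft G e, eright G e} \<and> 0 < len G e"
    and "\<And>e t. e \<in> edges G \<Longrightarrow> v \<in> e \<Longrightarrow> t \<in> {0..len G e} \<Longrightarrow> f e t = g e t"
  shows "normal_deriv G f v = normal_deriv G g v"
proof -
  have "deriv_on (len G e) (f e) x = deriv_on (len G e) (g e) x"
    if "e \<in> edges G" "eleft G e = v \<or> eright G e = v" "x \<in> {0..len G e}" for e x
  proof (rule deriv_on_cong[OF that(3)])
    have "v \<in> e" using that(2) assms(1)[OF that(1)] by blast
    then show "f e t = g e t" if "t \<in> {0..len G e}" for t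
      using assms(2) that \<open>e \<in> edges G\<close> by blast
  qed
  moreover have "0 \<in> {0..len G e}" "len G e \<in> {0..len G e}" if "e \<in> edges G" for e
    using assms(1)[OF that] by auto
  ultimately show ?thesis
    unfolding normal_deriv_def by (intro arg_cong2[of _ _ _ _ "(+)"] arg_cong[of _ _ uminus] sum.cong) auto
qed

locale connected_graph =
  fixes G :: "'v quantum_graph"
  assumes conn: "connected_quantum_graph G"
begin

lemma finite_verts: "finite (verts G)"
  and edge_subset: "e \<in> edges G \<Longrightarrow> e \<subseteq> verts G"
  and edge_ends: "e \<in> edges G \<Longrightarrow> e = {eleft G e, eright G e}"
  and ends_neq: "e \<in> edges G \<Longrightarrow> eleft G e \<noteq> eright G e"
  and len_pos: "e \<in> edges G \<Longrightarrow> 0 < len G e"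
  and ex_path: "v \<in> verts G \<Longrightarrow> w \<in> verts G \<Longrightarrow> \<exists>p. path_between G v p w"
  using conn unfolding connected_quantum_graph_def by auto

lemma finite_edges: "finite (edges G)"
  using finite_verts edge_subset by (meson Pow_iff finite_Pow_iff finite_subset subsetI)

lemma ends_in: "e \<in> edges G \<Longrightarrow> eleft G e \<in> e \<and> eright G e \<in> e"
  using edge_ends by blast

lemma edge_eq_pair:
  assumes "e \<in> edges G" "c \<in> e" "v \<in> e" "c \<noteq> v"
  shows "{c, v} = e"
proof -
  obtain l r where "e = {l, r}" using edge_ends[OF assms(1)] by blast
  then show ?thesis using assms(2-4) by auto
qed

lemma ends_in_verts: "e \<in> edges G \<Longrightarrow> eleft G e \<in> verts G \<and> eright G e \<in> verts G"
  using ends_in edge_subset by blast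

lemma ex_incident_edge:
  assumes v: "v \<in> verts G"
  shows "\<exists>e\<in>edges G. v \<in> e"
proof -
  obtain e where e: "e \<in> edges G" using conn unfolding connected_quantum_graph_def by auto
  obtain w where w: "w \<in> verts G" "w \<noteq> v" using ends_in_verts[OF e] ends_neq[OF e] by metis
  obtain p where p: "path_between G v p w" using ex_path v w by blast
  then obtain u q where "p = v # u # q"
    using w unfolding path_between_def is_path_def
    by (metis last_ConsL list.collapse)
  then have "{v, u} \<in> edges G" using p unfolding path_between_def is_path_def by auto
  then show ?thesis by blast
qed

lemma end_value_vertex_values:
  assumes "vertex_values G f y" "e \<in> edges G" "v \<in> e"
  shows "end_value G f e v = y v"
  using assms edge_ends[OF assms(2)] unfolding vertex_values_def end_value_def by auto

lemma gtrace_eq: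
  assumes f: "vertex_values G f y" and v: "v \<in> verts G"
  shows "gtrace G f v = y v"
proof -
  obtain e where e: "e \<in> edges G" "v \<in> e" using ex_incident_edge[OF v] by blast
  show ?thesis unfolding gtrace_def
    by (rule the_equality) (use end_value_vertex_values[OF f] e in auto)
qed

lemma continuous_iff_vertex_values:
  "(\<forall>v\<in>verts G. \<forall>e\<in>edges G. \<forall>e'\<in>edges G. v \<in> e \<and> v \<in> e' \<longrightarrow>
        end_value G f e v = end_value G f e' v) \<longleftrightarrow> (\<exists>y. vertex_values G f y)"
proof
  assume L: "\<forall>v\<in>verts G. \<forall>e\<in>edges G. \<forall>e'\<in>edges G. v \<in> e \<and> v \<in> e' \<longrightarrow>
        end_value G f e v = end_value G f e' v"
  define y where "y v = end_value G f (SOME e. e \<in> edges G \<and> v \<in> e) v" for v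
  have y: "end_value G f e v = y v" if "e \<in> edges G" "v \<in> e" for e v
  proof -
    have "\<exists>e. e \<in> edges G \<and> v \<in> e" using that by blast
    from someI_ex[OF this] show ?thesis
      unfolding y_def using L that edge_subset by blast
  qed
  have "vertex_values G f y"
    unfolding vertex_values_def
  proof (intro ballI conjI)
    fix e assume e: "e \<in> edges G"
    show "f e 0 = y (eleft G e)" "f e (len G e) = y (eright G e)"
      using y[OF e, of "eleft G e"] y[OF e, of "eright G e"] ends_in[OF e] ends_neq[OF e]
      by (auto simp: end_value_def)
  qed
  then show "\<exists>y. vertex_values G f y" by blast
next
  assume "\<exists>y. vertex_values G f y"
  then show "\<forall>v\<in>verts G. \<forall>e\<in>edges G. \<forall>e'\<in>edges G. v \<in> e \<and> v \<in> e' \<longrightarrow>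
        end_value G f e v = end_value G f e' v"
    using end_value_vertex_values by metis
qed

lemma Delta_max_iff:
  "(f, g) \<in> Delta_max G \<longleftrightarrow>
     (\<forall>e\<in>edges G. H2_interval (len G e) (f e) (g e)) \<and> (\<exists>y. vertex_values G f y)"
  unfolding Delta_max_def continuous_iff_vertex_values[symmetric] by simp

lemma DtN_solution_iff:
  assumes Vo: "Vo \<subseteq> verts G"
  shows "DtN_solution G Vo z x f \<longleftrightarrow>
    (\<exists>y. helmholtz_graph G z f y \<and> (\<forall>v\<in>Vo. y v = x v) \<and>
         (\<forall>v\<in>verts G - Vo. normal_deriv G f v = 0))"
proof -
  have "(\<exists>g. (f, g) \<in> Delta_max G \<and> L2_eq G (\<lambda>e t. g e t + z * f e t) (\<lambda>e t. 0)) \<longleftrightarrow>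
    (\<exists>y. helmholtz_graph G z f y)" (is "?L \<longleftrightarrow> ?R")
  proof
    assume ?L
    then show ?R
      unfolding Delta_max_iff L2_eq_def helmholtz_graph_def
      using helmholtz_on_iff_H2[OF len_pos] by blast
  next
    assume ?R
    then obtain y where y: "vertex_values G f y"
      and h: "\<forall>e\<in>edges G. helmholtz_on (len G e) z (f e)" unfolding helmholtz_graph_def by blast
    have "\<forall>e\<in>edges G. \<exists>h. H2_interval (len G e) (f e) h \<and>
       (AE x in lebesgue_on {0..len G e}. h x + z * f e x = 0)"
      using h helmholtz_on_iff_H2[OF len_pos] by blast
    then obtain g where "\<forall>e\<in>edges G. H2_interval (len G e) (f e) (g e) \<and>
       (AE x in lebesgue_on {0..len G e}. g e x + z * f e x = 0)"
      by metis
    then show ?L unfolding Delta_max_iff L2_eq_def using y by blast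
  qed
  moreover have "(\<forall>v\<in>Vo. gtrace G f v = x v) \<longleftrightarrow> (\<forall>v\<in>Vo. y v = x v)"
    if "helmholtz_graph G z f y" for y
    using that gtrace_eq Vo unfolding helmholtz_graph_def by (metis subsetD)
  ultimately show ?thesis unfolding DtN_solution_def by blast
qed

lemma helmholtz_graph_lincomb:
  assumes f: "helmholtz_graph G z f y" and g: "helmholtz_graph G z g y'"
  shows "helmholtz_graph G z (\<lambda>e t. a * f e t + b * g e t) (\<lambda>v. a * y v + b * y' v)"
    and "normal_deriv G (\<lambda>e t. a * f e t + b * g e t) v
         = a * normal_deriv G f v + b * normal_deriv G g v"
proof -
  show "helmholtz_graph G z (\<lambda>e t. a * f e t + b * g e t) (\<lambda>v. a * y v + b * y' v)"
    using f g len_pos helmholtz_on_lincomb(1)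
    unfolding helmholtz_graph_def vertex_values_def by auto
  have d: "deriv_on (len G e) (\<lambda>t. a * f e t + b * g e t) x
      = a * deriv_on (len G e) (f e) x + b * deriv_on (len G e) (g e) x"
    if "e \<in> edges G" "x \<in> {0..len G e}" for e x
    using that f g len_pos helmholtz_on_lincomb(2) unfolding helmholtz_graph_def by blast
  have d0: "deriv_on (len G e) (\<lambda>t. a * f e t + b * g e t) 0
      = a * deriv_on (len G e) (f e) 0 + b * deriv_on (len G e) (g e) 0"
    "deriv_on (len G e) (\<lambda>t. a * f e t + b * g e t) (len G e)
      = a * deriv_on (len G e) (f e) (len G e) + b * deriv_on (len G e) (g e) (len G e)"
    if "e \<in> edges G" for e
    using d[OF that] len_pos[OF that] by auto
  show "normal_deriv G (\<lambda>e t. a * f e t + b * g e t) v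
         = a * normal_deriv G f v + b * normal_deriv G g v"
    unfolding normal_deriv_def
    by (simp add: d0 sum.distrib sum_distrib_left algebra_simps)
qed

lemma helmholtz_graph_zero: "helmholtz_graph G z (\<lambda>e t. 0) (\<lambda>v. 0)"
  unfolding helmholtz_graph_def vertex_values_def
  using len_pos by (auto intro!: helmholtz_onI[where ?f1.0 = "\<lambda>_. 0"])

lemma normal_deriv_zero: "normal_deriv G (\<lambda>e t. 0) v = 0"
  using helmholtz_graph_lincomb(2)[OF helmholtz_graph_zero helmholtz_graph_zero, of 0 0 v] by simp

lemma helmholtz_graph_sum:
  assumes "finite I" "\<And>i. i \<in> I \<Longrightarrow> helmholtz_graph G z (\<phi> i) (\<eta> i)"
  shows "helmholtz_graph G z (\<lambda>e t. \<Sum>i\<in>I. c i * \<phi> i e t) (\<lambda>v. \<Sum>i\<in>I. c i * \<eta> i v)"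
    and "normal_deriv G (\<lambda>e t. \<Sum>i\<in>I. c i * \<phi> i e t) v = (\<Sum>i\<in>I. c i * normal_deriv G (\<phi> i) v)"
proof -
  have "helmholtz_graph G z (\<lambda>e t. \<Sum>i\<in>I. c i * \<phi> i e t) (\<lambda>v. \<Sum>i\<in>I. c i * \<eta> i v) \<and>
    normal_deriv G (\<lambda>e t. \<Sum>i\<in>I. c i * \<phi> i e t) v = (\<Sum>i\<in>I. c i * normal_deriv G (\<phi> i) v)"
    using assms
  proof (induction I)
    case empty
    then show ?case using helmholtz_graph_zero normal_deriv_zero by simp
  next
    case (insert j I)
    then have j: "helmholtz_graph G z (\<phi> j) (\<eta> j)"
      and I: "helmholtz_graph G z (\<lambda>e t. \<Sum>i\<in>I. c i * \<phi> i e t) (\<lambda>v. \<Sum>i\<in>I. c i * \<eta> i v)"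
      "normal_deriv G (\<lambda>e t. \<Sum>i\<in>I. c i * \<phi> i e t) v = (\<Sum>i\<in>I. c i * normal_deriv G (\<phi> i) v)"
      by auto
    show ?case
      using helmholtz_graph_lincomb[OF j I(1), of "c j" 1] I(2) insert.hyps by simp
  qed
  then show "helmholtz_graph G z (\<lambda>e t. \<Sum>i\<in>I. c i * \<phi> i e t) (\<lambda>v. \<Sum>i\<in>I. c i * \<eta> i v)"
    and "normal_deriv G (\<lambda>e t. \<Sum>i\<in>I. c i * \<phi> i e t) v = (\<Sum>i\<in>I. c i * normal_deriv G (\<phi> i) v)"
    by auto
qed

text \<open>Each edge contributes to the normal derivative at its two ends only, which turns the sum over the
  vertices into the boundary terms of an integration by parts on the edges.\<close>

lemma sum_normal_deriv:
  "(\<Sum>v\<in>verts G. normal_deriv G f v * y v) =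
   (\<Sum>e\<in>edges G. deriv_on (len G e) (f e) (len G e) * y (eright G e)
                - deriv_on (len G e) (f e) 0 * y (eleft G e))"
proof -
  have *: "(\<Sum>v\<in>verts G. (\<Sum>e | e \<in> edges G \<and> h e = v. d e) * y v) = (\<Sum>e\<in>edges G. d e * y (h e))"
    if "\<And>e. e \<in> edges G \<Longrightarrow> h e \<in> verts G" for h and d :: "'v set \<Rightarrow> complex"
  proof -
    have "(\<Sum>v\<in>verts G. (\<Sum>e | e \<in> edges G \<and> h e = v. d e) * y v)
        = (\<Sum>v\<in>verts G. \<Sum>e | e \<in> edges G \<and> h e = v. d e * y (h e))"
      by (auto simp: sum_distrib_right intro!: sum.cong)
    also have "\<dots> = (\<Sum>e\<in>edges G. d e * y (h e))"
      using that by (intro sum.group finite_edges finite_verts) auto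
    finally show ?thesis .
  qed
  show ?thesis
    unfolding normal_deriv_def
    using *[of "eleft G" "\<lambda>e. deriv_on (len G e) (f e) 0"]
      *[of "eright G" "\<lambda>e. deriv_on (len G e) (f e) (len G e)"] ends_in_verts
    by (simp add: ring_distribs sum.distrib sum_subtractf sum_negf)
qed

text \<open>Green's identity. On each edge the difference of the two sides is the difference of the Wronskian
  at the two end points.\<close>

lemma green_symmetry:
  assumes f: "helmholtz_graph G z f y" and g: "helmholtz_graph G z g y'"
  shows "(\<Sum>v\<in>verts G. normal_deriv G f v * y' v) = (\<Sum>v\<in>verts G. normal_deriv G g v * y v)"
  unfolding sum_normal_deriv
proof (rule sum.cong[OF refl])
  fix e assume e: "e \<in> edges G"
  have "f e 0 = y (eleft G e)" "f e (len G e) = y (eright G e)"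
    "g e 0 = y' (eleft G e)" "g e (len G e) = y' (eright G e)"
    using f g e unfolding helmholtz_graph_def vertex_values_def by auto
  then show "deriv_on (len G e) (f e) (len G e) * y' (eright G e)
                - deriv_on (len G e) (f e) 0 * y' (eleft G e) =
     deriv_on (len G e) (g e) (len G e) * y (eright G e)
                - deriv_on (len G e) (g e) 0 * y (eleft G e)"
    using wronskian_constant[OF len_pos[OF e], of z "f e" "g e"] f g e
    unfolding helmholtz_graph_def by (simp add: algebra_simps)
qed

section \<open>Unique solvability off the spectrum\<close>

text \<open>Under homogeneous boundary conditions \<open>f\<close> belongs to the domain of the Laplacian and has the same
  image as \<open>0\<close> under \<open>- \<Delta> - z\<close>. Injectivity gives \<open>f = 0\<close> almost everywhere only; continuity of \<open>f\<close>
  does the rest.\<close>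

lemma helmholtz_graph_unique:
  assumes Vo: "Vo \<subseteq> verts G" and z: "z \<notin> op_spectrum G (neg_op (Delta G Vo))"
    and f: "helmholtz_graph G z f y"
    and y: "\<forall>v\<in>Vo. y v = 0" and nd: "\<forall>v\<in>verts G - Vo. normal_deriv G f v = 0"
  shows "e \<in> edges G \<Longrightarrow> t \<in> {0..len G e} \<Longrightarrow> f e t = 0"
    and "v \<in> verts G \<Longrightarrow> y v = 0" and "normal_deriv G f v = 0"
proof -
  have mem: "(u, \<lambda>e t. z * u e t) \<in> neg_op (Delta G Vo)"
    if u: "helmholtz_graph G z u x" "\<forall>v\<in>Vo. x v = 0" "\<forall>v\<in>verts G - Vo. normal_deriv G u v = 0"
    for u x
  proof -
    have "H2_interval (len G e) (u e) (\<lambda>t. - z * u e t)" if e: "e \<in> edges G" for e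
      using helmholtz_on_H2_interval[OF len_pos[OF e]] u e unfolding helmholtz_graph_def by blast
    then have "(u, \<lambda>e t. - z * u e t) \<in> Delta_max G"
      unfolding Delta_max_iff using u unfolding helmholtz_graph_def by blast
    moreover have "\<forall>v\<in>Vo. gtrace G u v = 0"
      using u gtrace_eq Vo unfolding helmholtz_graph_def by (metis subsetD)
    ultimately have "(u, \<lambda>e t. - z * u e t) \<in> Delta G Vo" using u unfolding Delta_def by auto
    then show ?thesis unfolding neg_op_def by force
  qed
  have inj: "\<forall>(f, g)\<in>neg_op (Delta G Vo). \<forall>(f', g')\<in>neg_op (Delta G Vo).
        L2_eq G (\<lambda>e x. g e x - z * f e x) (\<lambda>e x. g' e x - z * f' e x) \<longrightarrow> L2_eq G f f'"
    using z unfolding op_spectrum_def resolvent_set_def by auto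
  have "L2_eq G f (\<lambda>e t. 0)"
    using inj[rule_format, OF mem[OF f y nd], simplified, rule_format,
        OF mem[OF helmholtz_graph_zero]]
    by (auto simp: normal_deriv_zero L2_eq_def)
  then have ae: "AE x in lebesgue_on {0..len G e}. f e x = 0" if "e \<in> edges G" for e
    using that unfolding L2_eq_def by auto
  show f0: "f e t = 0" if "e \<in> edges G" "t \<in> {0..len G e}" for e t
    using continuous_AE_zero_imp_zero[OF len_pos _ ae] that f helmholtz_on_continuous
    unfolding helmholtz_graph_def by blast
  show "y v = 0" if v: "v \<in> verts G" for v
  proof -
    obtain e where e: "e \<in> edges G" "v \<in> e" using ex_incident_edge[OF v] by blast
    then show ?thesis using f f0[OF e(1)] edge_ends[OF e(1)] len_pos[OF e(1)]
      unfolding helmholtz_graph_def vertex_values_def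
      by (metis atLeastAtMost_iff empty_iff insertE less_eq_real_def)
  qed
  have "normal_deriv G f v = normal_deriv G (\<lambda>e t. 0) v"
    using f0 edge_ends len_pos by (intro normal_deriv_cong) auto
  then show "normal_deriv G f v = 0" by (simp add: normal_deriv_zero)
qed

text \<open>Let \<open>F\<close> be a smooth extension of the boundary data to the graph whose derivative vanishes at all
  ends of edges. Then \<open>f + F\<close> solves the problem as
  soon as \<open>f\<close> satisfies homogeneous boundary conditions and \<open>(- \<Delta> - z) f = F'' + z F\<close>, and such an
  \<open>f\<close> is provided by the resolvent.\<close>

lemma helmholtz_graph_exists:
  assumes Vo: "Vo \<subseteq> verts G" and z: "z \<notin> op_spectrum G (neg_op (Delta G Vo))"
  shows "\<exists>f y. helmholtz_graph G z f y \<and> (\<forall>v\<in>Vo. y v = x v) \<and>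
    (\<forall>v\<in>verts G - Vo. normal_deriv G f v = 0)"
proof -
  \<comment> \<open>Hermite interpolation: \<open>3 s\<^sup>2 - 2 s\<^sup>3\<close> rises from \<open>0\<close> to \<open>1\<close> on \<open>[0,1]\<close> with vanishing derivative at
    both ends, so adding \<open>F\<close> does not change any normal derivative.\<close>
  define a where "a v = (if v \<in> Vo then x v else 0)" for v
  define b where "b e = a (eright G e) - a (eleft G e)" for e
  define F where "F e t = a (eleft G e) +
    b e * of_real (3 * (t / len G e)^2 - 2 * (t / len G e)^3)" for e t
  define F1 where "F1 e t = b e * of_real (6 * (t / len G e - (t / len G e)^2) / len G e)" for e t
  define F2 where "F2 e t = b e * of_real (6 * (1 - 2 * (t / len G e)) / (len G e)^2)" for e t
  have dF: "(F e has_vector_derivative F1 e t) (at t within S)"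
    and dF1: "(F1 e has_vector_derivative F2 e t) (at t within S)" if e: "e \<in> edges G" for e t S
  proof -
    have scale: "((\<lambda>t. t / len G e) has_real_derivative 1 / len G e) (at t within S)"
      by (rule DERIV_cdivide[OF DERIV_ident])
    have cubic: "((\<lambda>s. 3 * s^2 - 2 * s^3) has_real_derivative 6 * (s - s^2)) (at s)" for s :: real
      by (auto intro!: derivative_eq_intros simp: algebra_simps)
    have quadratic: "((\<lambda>s. 6 * (s - s^2)) has_real_derivative 6 * (1 - 2 * s)) (at s)" for s :: real
      by (auto intro!: derivative_eq_intros)
    have "((\<lambda>t. 3 * (t / len G e)^2 - 2 * (t / len G e)^3) has_real_derivative
       6 * (t / len G e - (t / len G e)^2) / len G e) (at t within S)"
      using DERIV_chain'[OF scale cubic] by simp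
    then have "((\<lambda>t. of_real (3 * (t / len G e)^2 - 2 * (t / len G e)^3) :: complex)
       has_vector_derivative of_real (6 * (t / len G e - (t / len G e)^2) / len G e)) (at t within S)"
      by (rule has_vector_derivative_of_real)
    from has_vector_derivative_add[OF has_vector_derivative_const[of "a (eleft G e)"]
        has_vector_derivative_mult_right[OF this, of "b e"]]
    show "(F e has_vector_derivative F1 e t) (at t within S)"
      unfolding F_def[abs_def] F1_def by (simp only: add_0_left)
    have "((\<lambda>t. 6 * (t / len G e - (t / len G e)^2) / len G e) has_real_derivative
       6 * (1 - 2 * (t / len G e)) / (len G e)^2) (at t within S)"
      using DERIV_cdivide[OF DERIV_chain'[OF scale quadratic], of "len G e"]
      by (simp add: power2_eq_square)
    then have "((\<lambda>t. of_real (6 * (t / len G e - (t / len G e)^2) / len G e) :: complex)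
       has_vector_derivative of_real (6 * (1 - 2 * (t / len G e)) / (len G e)^2)) (at t within S)"
      by (rule has_vector_derivative_of_real)
    from has_vector_derivative_mult_right[OF this, of "b e"]
    show "(F1 e has_vector_derivative F2 e t) (at t within S)"
      unfolding F1_def[abs_def] F2_def .
  qed
  have F_ends: "F e 0 = a (eleft G e)" "F e (len G e) = a (eright G e)"
    "F1 e 0 = 0" "F1 e (len G e) = 0" if "e \<in> edges G" for e
    using len_pos[OF that] unfolding F_def F1_def b_def by (auto simp: power2_eq_square)
  have cF: "continuous_on {0..len G e} (F e)" "continuous_on {0..len G e} (F2 e)"
    if "e \<in> edges G" for e
    unfolding F_def F2_def using len_pos[OF that] by (intro continuous_intros; simp)+
  define h where "h e t = F2 e t + z * F e t" for e t
  have ch: "continuous_on {0..len G e} (h e)" if "e \<in> edges G" for e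
    unfolding h_def using cF[OF that] by (intro continuous_intros)
  have "h \<in> L2_graph G" unfolding L2_graph_def using continuous_L2_interval[OF ch] by blast
  moreover have "\<forall>h\<in>L2_graph G. \<exists>(f, g)\<in>neg_op (Delta G Vo). L2_eq G (\<lambda>e x. g e x - z * f e x) h"
    using z unfolding op_spectrum_def resolvent_set_def by auto
  ultimately obtain f g where fg: "(f, g) \<in> neg_op (Delta G Vo)"
    "L2_eq G (\<lambda>e x. g e x - z * f e x) h" by blast
  then obtain g' where fg': "(f, g') \<in> Delta G Vo" "g = (\<lambda>e x. - g' e x)"
    unfolding neg_op_def by auto
  then have max: "(f, g') \<in> Delta_max G" and tr: "\<forall>v\<in>Vo. gtrace G f v = 0"
    and nd: "\<forall>v\<in>verts G - Vo. normal_deriv G f v = 0" unfolding Delta_def by auto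
  from max obtain y where y: "vertex_values G f y"
    and H: "\<forall>e\<in>edges G. H2_interval (len G e) (f e) (g' e)" unfolding Delta_max_iff by blast
  have y0: "y v = 0" if "v \<in> Vo" for v using tr gtrace_eq[OF y, of v] that Vo by (metis subsetD)
  have df: "(f e has_vector_derivative deriv_on (len G e) (f e) t) (at t within {0..len G e})"
    "(deriv_on (len G e) (f e) has_vector_derivative - z * f e t - h e t) (at t within {0..len G e})"
    if e: "e \<in> edges G" and t: "t \<in> {0..len G e}" for e t
  proof -
    have He: "H2_interval (len G e) (f e) (g' e)" using H e by auto
    have "AE x in lebesgue_on {0..len G e}. g e x - z * f e x = h e x"
      using fg(2) e unfolding L2_eq_def by auto
    then have ae: "AE x in lebesgue_on {0..len G e}. g' e x = - z * f e x - h e x"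
    proof eventually_elim
      case (elim x)
      then show ?case unfolding elim[symmetric] fg'(2) by simp
    qed
    have "continuous_on {0..len G e} (f e)"
      using He differentiable_imp_continuous_on unfolding H2_interval_def by blast
    then have "continuous_on {0..len G e} (\<lambda>x. - z * f e x - h e x)"
      using ch[OF e] by (intro continuous_intros)
    from H2_interval_deriv[OF He ae this t]
    show "(f e has_vector_derivative deriv_on (len G e) (f e) t) (at t within {0..len G e})"
      "(deriv_on (len G e) (f e) has_vector_derivative - z * f e t - h e t) (at t within {0..len G e})"
      by auto
  qed
  define u where "u e t = f e t + F e t" for e t
  have du: "(u e has_vector_derivative deriv_on (len G e) (f e) t + F1 e t) (at t within {0..len G e})"
    if "e \<in> edges G" "t \<in> {0..len G e}" for e t
    unfolding u_def using df(1) dF that by (intro derivative_intros) auto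
  have du1: "((\<lambda>t. deriv_on (len G e) (f e) t + F1 e t) has_vector_derivative - z * u e t)
      (at t within {0..len G e})" if e: "e \<in> edges G" "t \<in> {0..len G e}" for e t
  proof -
    have "((\<lambda>t. deriv_on (len G e) (f e) t + F1 e t) has_vector_derivative
      (- z * f e t - h e t) + F2 e t) (at t within {0..len G e})"
      using df(2)[OF e] dF1 e by (intro derivative_intros) auto
    then show ?thesis by (simp add: u_def h_def algebra_simps)
  qed
  have "helmholtz_graph G z u (\<lambda>v. y v + a v)"
    unfolding helmholtz_graph_def
  proof
    show "\<forall>e\<in>edges G. helmholtz_on (len G e) z (u e)"
      using helmholtz_onI[OF len_pos du du1] by blast
    show "vertex_values G u (\<lambda>v. y v + a v)"
      using y F_ends unfolding vertex_values_def u_def by auto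
  qed
  moreover have "normal_deriv G u v = normal_deriv G f v" for v
  proof -
    have "deriv_on (len G e) (u e) 0 = deriv_on (len G e) (f e) 0"
      "deriv_on (len G e) (u e) (len G e) = deriv_on (len G e) (f e) (len G e)"
      if e: "e \<in> edges G" for e
      using deriv_on_eqI[OF len_pos[OF e] _ du[OF e]] len_pos[OF e] F_ends[OF e] by auto
    then show ?thesis unfolding normal_deriv_def by simp
  qed
  ultimately show ?thesis
    using y0 nd by (intro exI[of _ u] exI[of _ "\<lambda>v. y v + a v"]) (auto simp: a_def)
qed

text \<open>The definite description in \<open>DtN\<close> is resolved by the normal derivative of any one solution, since
  two solutions differ by a solution of the homogeneous problem.\<close>

lemma DtN_eq_normal_deriv:
  assumes Vo: "Vo \<subseteq> verts G" and z: "z \<notin> op_spectrum G (neg_op (Delta G Vo))"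
    and f: "helmholtz_graph G z f y" and y: "\<forall>v\<in>Vo. y v = x v"
    and nd: "\<forall>v\<in>verts G - Vo. normal_deriv G f v = 0" and v: "v \<in> Vo"
  shows "DtN G Vo z x v = normal_deriv G f v"
proof -
  have "DtN G Vo z x = restrict (normal_deriv G f) Vo"
    unfolding DtN_def
  proof (rule the_equality)
    show "\<exists>f'. DtN_solution G Vo z x f' \<and>
        restrict (normal_deriv G f) Vo = restrict (normal_deriv G f') Vo"
      using f y nd DtN_solution_iff[OF Vo] by blast
    fix d assume "\<exists>f'. DtN_solution G Vo z x f' \<and> d = restrict (normal_deriv G f') Vo"
    then obtain f' y' where f': "helmholtz_graph G z f' y'" "\<forall>v\<in>Vo. y' v = x v"
      "\<forall>v\<in>verts G - Vo. normal_deriv G f' v = 0" and d: "d = restrict (normal_deriv G f') Vo"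
      using DtN_solution_iff[OF Vo] by blast
    have "normal_deriv G (\<lambda>e t. 1 * f' e t + (-1) * f e t) v = 0" for v
      by (rule helmholtz_graph_unique(3)[OF Vo z helmholtz_graph_lincomb(1)[OF f'(1) f]])
        (use f' nd y helmholtz_graph_lincomb(2)[OF f'(1) f, of 1 "-1"] in auto)
    then have "normal_deriv G f' v = normal_deriv G f v" for v
      using helmholtz_graph_lincomb(2)[OF f'(1) f, of 1 "-1" v] by simp
    then show "d = restrict (normal_deriv G f) Vo" unfolding d by auto
  qed
  then show ?thesis using v by simp
qed


text \<open>By linearity, superposing the solutions with unit boundary data, weighted by the values of \<open>y\<close>,
  gives a solution with vertex values \<open>y\<close>; its normal derivative is that of \<open>f\<close>, because the data
  on all vertices determine it.\<close>

lemma normal_deriv_expansion: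
  assumes z: "z \<notin> op_spectrum G (neg_op (Delta G (verts G)))"
    and f: "helmholtz_graph G z f y" and w: "w \<in> verts G"
  shows "normal_deriv G f w =
    (\<Sum>u\<in>verts G. DtN G (verts G) z (\<lambda>v. if v = u then 1 else 0) w * y u)"
proof -
  have "\<exists>g \<eta>. helmholtz_graph G z g \<eta> \<and> (\<forall>v\<in>verts G. \<eta> v = (if v = u then 1 else 0))" for u
    using helmholtz_graph_exists[OF subset_refl z, of "\<lambda>v. if v = u then 1 else 0"] by blast
  then obtain \<phi> \<eta> where \<phi>: "\<And>u. helmholtz_graph G z (\<phi> u) (\<eta> u)"
    and \<eta>: "\<And>u. \<forall>v\<in>verts G. \<eta> u v = (if v = u then 1 else 0)" by metis
  let ?g = "\<lambda>e t. \<Sum>u\<in>verts G. y u * \<phi> u e t"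
  have tr: "(\<Sum>u\<in>verts G. y u * \<eta> u v) = y v" if v: "v \<in> verts G" for v
  proof -
    have "(\<Sum>u\<in>verts G. y u * \<eta> u v) = (\<Sum>u\<in>verts G. if v = u then y u else 0)"
      using \<eta> v by (intro sum.cong refl) simp
    then show ?thesis using v finite_verts by (simp add: sum.delta)
  qed
  have "normal_deriv G f w = DtN G (verts G) z y w"
    using DtN_eq_normal_deriv[OF subset_refl z f, of y w] w by simp
  also have "\<dots> = normal_deriv G ?g w"
    by (rule DtN_eq_normal_deriv[OF subset_refl z helmholtz_graph_sum(1)[OF finite_verts \<phi>]])
      (use tr w in auto)
  also have "\<dots> = (\<Sum>u\<in>verts G. y u * normal_deriv G (\<phi> u) w)"
    by (rule helmholtz_graph_sum(2)[OF finite_verts \<phi>])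
  also have "\<dots> = (\<Sum>u\<in>verts G. DtN G (verts G) z (\<lambda>v. if v = u then 1 else 0) w * y u)"
  proof (rule sum.cong[OF refl])
    fix u
    have "DtN G (verts G) z (\<lambda>v. if v = u then 1 else 0) w = normal_deriv G (\<phi> u) w"
      by (rule DtN_eq_normal_deriv[OF subset_refl z \<phi> \<eta> _ w]) simp
    then show "y u * normal_deriv G (\<phi> u) w =
      DtN G (verts G) z (\<lambda>v. if v = u then 1 else 0) w * y u" by simp
  qed
  finally show ?thesis .
qed

text \<open>Green's identity for the solutions with unit data at \<open>u\<close> and at \<open>w\<close>: each of the two sums reduces
  to a single normal derivative.\<close>

lemma DtN_symmetric:
  assumes z: "z \<notin> op_spectrum G (neg_op (Delta G (verts G)))"
    and u: "u \<in> verts G" and w: "w \<in> verts G"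
  shows "DtN G (verts G) z (\<lambda>v. if v = u then 1 else 0) w =
    DtN G (verts G) z (\<lambda>v. if v = w then 1 else 0) u"
proof -
  obtain f y where f: "helmholtz_graph G z f y" and y: "\<forall>v\<in>verts G. y v = (if v = u then 1 else 0)"
    using helmholtz_graph_exists[OF subset_refl z, of "\<lambda>v. if v = u then 1 else 0"] by blast
  obtain g y' where g: "helmholtz_graph G z g y'" and y': "\<forall>v\<in>verts G. y' v = (if v = w then 1 else 0)"
    using helmholtz_graph_exists[OF subset_refl z, of "\<lambda>v. if v = w then 1 else 0"] by blast
  have delta: "(\<Sum>v\<in>verts G. h v * x v) = h r"
    if r: "r \<in> verts G" and x: "\<forall>v\<in>verts G. x v = (if v = r then 1 else 0)"
    for h x :: "'v \<Rightarrow> complex" and r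
  proof -
    have "(\<Sum>v\<in>verts G. h v * x v) = (\<Sum>v\<in>verts G. if v = r then h v else 0)"
      using x by (intro sum.cong refl) simp
    then show ?thesis using r finite_verts by (simp add: sum.delta')
  qed
  have "normal_deriv G f w = (\<Sum>v\<in>verts G. normal_deriv G f v * y' v)"
    by (rule delta[OF w y', symmetric])
  also have "\<dots> = (\<Sum>v\<in>verts G. normal_deriv G g v * y v)"
    by (rule green_symmetry[OF f g])
  also have "\<dots> = normal_deriv G g u"
    by (rule delta[OF u y])
  finally have "normal_deriv G f w = normal_deriv G g u" .
  then show ?thesis
    using DtN_eq_normal_deriv[OF subset_refl z f y _ w] DtN_eq_normal_deriv[OF subset_refl z g y' _ u]
    by simp
qed

section \<open>Locality\<close>

text \<open>The condition concerns \<open>tl p\<close> because the starting point \<open>s\<close> is an outer vertex in all uses.\<close>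

definition inner_reach :: "'v set \<Rightarrow> 'v \<Rightarrow> 'v set" where
  "inner_reach Vo s = {c. \<exists>p. path_between G s p c \<and> set (tl p) \<subseteq> verts G - Vo}"

lemma inner_reach_self: "s \<in> verts G \<Longrightarrow> s \<in> inner_reach Vo s"
  unfolding inner_reach_def path_between_def is_path_def
  by (intro CollectI exI[of _ "[s]"]) auto

lemma inner_reach_inner: "c \<in> inner_reach Vo s \<Longrightarrow> c \<noteq> s \<Longrightarrow> c \<in> verts G - Vo"
  unfolding inner_reach_def path_between_def is_path_def
  by clarify (metis hd_Cons_tl last_ConsL last_in_set last_tl list.sel(1) subsetD)

lemma path_extend:
  assumes "path_between G s p c" "{c, u} \<in> edges G" "u \<notin> set p" "u \<in> verts G"
  shows "path_between G s (p @ [u]) u"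
  using assms unfolding path_between_def is_path_def by (auto simp: successively_append_iff)

text \<open>If \<open>u\<close> already occurs on the path to \<open>c\<close>, appending it would not give a path; the initial segment
  that ends at \<open>u\<close> is used instead.\<close>

lemma inner_reach_step:
  assumes s: "s \<in> Vo" and c: "c \<in> inner_reach Vo s" and cu: "{c, u} \<in> edges G"
    and u: "u \<in> verts G - Vo"
  shows "u \<in> inner_reach Vo s"
proof -
  obtain p where p: "path_between G s p c" "set (tl p) \<subseteq> verts G - Vo"
    using c unfolding inner_reach_def by blast
  then have ne: "p \<noteq> []" unfolding path_between_def is_path_def by auto
  show ?thesis
  proof (cases "u \<in> set p")
    case False
    have "path_between G s (p @ [u]) u" using path_extend p cu False u by blast
    moreover have "set (tl (p @ [u])) \<subseteq> verts G - Vo" using p u ne by auto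
    ultimately show ?thesis unfolding inner_reach_def by blast
  next
    case True
    then obtain q r where pq: "p = (q @ [u]) @ r" by (auto dest: split_list)
    then have "path_between G s (q @ [u]) u"
      using p(1) unfolding path_between_def is_path_def
      by (auto simp: successively_append_iff hd_append split: if_splits)
    moreover have "set (tl (q @ [u])) \<subseteq> verts G - Vo"
      using p(2) unfolding pq by (cases q) auto
    ultimately show ?thesis unfolding inner_reach_def by blast
  qed
qed

text \<open>The path to \<open>c\<close> continued by \<open>w\<close> is one of the paths that define reduced edges, unless \<open>c = s\<close>, where
  \<open>{s, w}\<close> is itself an edge.\<close>

lemma reduced_edge_from_inner_reach:
  assumes Vo: "Vo \<subseteq> verts G" and s: "s \<in> Vo" and c: "c \<in> inner_reach Vo s"
    and cw: "{c, w} \<in> edges G" and w: "w \<in> Vo" "w \<noteq> s"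
  shows "{s, w} \<in> reduced_edges G Vo"
proof (cases "c = s")
  case True
  then show ?thesis using cw s w unfolding reduced_edges_def by blast
next
  case False
  obtain p where p: "path_between G s p c" "set (tl p) \<subseteq> verts G - Vo"
    using c unfolding inner_reach_def by blast
  then obtain q where pq: "p = s # q" unfolding path_between_def is_path_def
    by (metis list.collapse)
  with p False have q: "q \<noteq> []" unfolding path_between_def by auto
  have "w \<notin> set p" using p(2) w pq by auto
  then have "path_between G s (p @ [w]) w" using path_extend p cw w Vo by blast
  moreover have "butlast (tl (p @ [w])) = q" using pq by simp
  ultimately have "path_between G s (p @ [w]) w \<and> butlast (tl (p @ [w])) \<noteq> [] \<and>
      set (butlast (tl (p @ [w]))) \<subseteq> verts G - Vo" using p(2) pq q by simp
  then show ?thesis using s w unfolding reduced_edges_def by blast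
qed

text \<open>The solution with unit data at \<open>s\<close> can be cut off outside the edges that meet \<open>inner_reach Vo s\<close>
  without losing any of its defining properties, and no edge at \<open>w\<close> survives the cut.\<close>

lemma DtN_zero_off_reduced_edges:
  assumes Vo: "Vo \<subseteq> verts G" and z: "z \<notin> op_spectrum G (neg_op (Delta G Vo))"
    and s: "s \<in> Vo" and w: "w \<in> Vo" "w \<noteq> s" and no: "{s, w} \<notin> reduced_edges G Vo"
  shows "DtN G Vo z (\<lambda>v. if v = s then 1 else 0) w = 0"
proof -
  obtain f y where f: "helmholtz_graph G z f y" and y: "\<forall>v\<in>Vo. y v = (if v = s then 1 else 0)"
    and nd: "\<forall>v\<in>verts G - Vo. normal_deriv G f v = 0"
    using helmholtz_graph_exists[OF Vo z, of "\<lambda>v. if v = s then 1 else 0"] by blast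
  define R where "R = inner_reach Vo s"
  define f' where "f' e t = (if e \<inter> R = {} then 0 else f e t)" for e t
  define y' where "y' v = (if v \<in> R then y v else 0)" for v
  have sR: "s \<in> R" unfolding R_def using inner_reach_self s Vo by blast
  have R_inner: "v \<in> verts G - Vo" if "v \<in> R" "v \<noteq> s" for v
    using that inner_reach_inner unfolding R_def by blast
  have R_step: "v \<in> R" if e: "e \<in> edges G" "e \<inter> R \<noteq> {}" "v \<in> e" and v: "v \<in> verts G - Vo" for e v
  proof (rule ccontr)
    assume nv: "v \<notin> R"
    obtain c where c: "c \<in> e" "c \<in> R" using e by blast
    then have "{c, v} = e" using edge_eq_pair e nv by blast
    then show False using inner_reach_step[OF s, of c v] c e v nv unfolding R_def by blast
  qed
  \<comment> \<open>The cut is continuous: where a surviving edge ends outside \<open>R\<close>, it ends at an outer vertex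
    other than \<open>s\<close>, and the boundary data vanish there.\<close>
  have R_end: "y v = y' v" if e: "e \<in> edges G" "e \<inter> R \<noteq> {}" "v \<in> e" for e v
  proof (cases "v \<in> R")
    case False
    then have "v \<in> Vo" "v \<noteq> s" using R_step[OF e] sR edge_subset[OF e(1)] e(3) by blast+
    then show ?thesis using y False unfolding y'_def by simp
  qed (simp add: y'_def)
  have no_meet: "y' v = 0" if "e \<inter> R = {}" "v \<in> e" for e v
    using that unfolding y'_def by auto
  have f': "helmholtz_graph G z f' y'"
    unfolding helmholtz_graph_def vertex_values_def
  proof (intro conjI ballI)
    fix e assume e: "e \<in> edges G"
    have fe: "helmholtz_on (len G e) z (f e)" "f e 0 = y (eleft G e)" "f e (len G e) = y (eright G e)"
      using f e unfolding helmholtz_graph_def vertex_values_def by auto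
    have "f' e = f e \<or> f' e = (\<lambda>t. 0)" unfolding f'_def by (cases "e \<inter> R = {}") simp_all
    then show "helmholtz_on (len G e) z (f' e)"
      using fe(1) helmholtz_graph_zero e unfolding helmholtz_graph_def by metis
    show "f' e 0 = y' (eleft G e)" "f' e (len G e) = y' (eright G e)"
      using R_end[OF e] no_meet[of e] ends_in[OF e] fe(2,3) unfolding f'_def by auto
  qed
  have off: "normal_deriv G f' v = 0" if "\<And>e. e \<in> edges G \<Longrightarrow> v \<in> e \<Longrightarrow> e \<inter> R = {}" for v
  proof -
    have "normal_deriv G f' v = normal_deriv G (\<lambda>e t. 0) v"
      using that edge_ends len_pos by (intro normal_deriv_cong) (auto simp: f'_def)
    then show ?thesis by (simp add: normal_deriv_zero)
  qed
  have nd': "\<forall>v\<in>verts G - Vo. normal_deriv G f' v = 0"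
  proof
    fix v assume v: "v \<in> verts G - Vo"
    show "normal_deriv G f' v = 0"
    proof (cases "v \<in> R")
      case True
      then have "normal_deriv G f' v = normal_deriv G f v"
        using edge_ends len_pos by (intro normal_deriv_cong) (auto simp: f'_def)
      then show ?thesis using nd v by simp
    next
      case False
      then show ?thesis using R_step v by (intro off) blast
    qed
  qed
  have "\<forall>v\<in>Vo. y' v = (if v = s then 1 else 0)"
    using y sR R_inner unfolding y'_def by auto
  from DtN_eq_normal_deriv[OF Vo z f' this nd' w(1)]
  have "DtN G Vo z (\<lambda>v. if v = s then 1 else 0) w = normal_deriv G f' w" .
  also have "\<dots> = 0"
  proof (rule off, rule ccontr)
    fix e assume e: "e \<in> edges G" "w \<in> e" "e \<inter> R \<noteq> {}"
    have "w \<notin> R" using R_inner w by blast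
    obtain c where c: "c \<in> e" "c \<in> R" using e by blast
    then have "{c, w} = e" using edge_eq_pair e \<open>w \<notin> R\<close> by blast
    then show False
      using reduced_edge_from_inner_reach[OF Vo s, of c w] e c w no unfolding R_def by blast
  qed
  finally show ?thesis .
qed

lemma DtN_mat_class_A:
  assumes Vo: "Vo \<subseteq> verts G" and z: "z \<notin> op_spectrum G (neg_op (Delta G Vo))"
    and v: "bij_betw v {..<card Vo} Vo"
  shows "DtN_mat G Vo v z \<in> class_A (card Vo) v (reduced_edges G Vo)"
proof -
  have "DtN G Vo z (\<lambda>w. if w = v j then 1 else 0) (v k) = 0"
    if "k < card Vo" "j < card Vo" "k \<noteq> j" "{v k, v j} \<notin> reduced_edges G Vo" for k j
  proof (rule DtN_zero_off_reduced_edges[OF Vo z])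
    show "v j \<in> Vo" "v k \<in> Vo" using that v bij_betw_apply by fastforce+
    show "v k \<noteq> v j" using that v unfolding bij_betw_def inj_on_def by auto
    show "{v j, v k} \<notin> reduced_edges G Vo" using that by (simp add: insert_commute)
  qed
  then show ?thesis unfolding class_A_def DtN_mat_def by auto
qed

section \<open>The Schur complement\<close>

lemma sum_lessThan_split:
  fixes f :: "nat \<Rightarrow> 'a::comm_monoid_add"
  assumes "m \<le> n"
  shows "(\<Sum>j<n. f j) = (\<Sum>j<m. f j) + (\<Sum>i<n - m. f (m + i))"
proof -
  have "(\<Sum>j<m + k. f j) = (\<Sum>j<m. f j) + (\<Sum>i<k. f (m + i))" for k
    by (induction k) (auto simp: add.assoc)
  from this[of "n - m"] show ?thesis using assms by simp
qed

lemma invertible_mat_of_trivial_kernel: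
  fixes C :: "'a::field mat"
  assumes C: "C \<in> carrier_mat k k"
    and ker: "\<And>c. c \<in> carrier_vec k \<Longrightarrow> C *\<^sub>v c = 0\<^sub>v k \<Longrightarrow> c = 0\<^sub>v k"
  obtains N where "invertible_mat C" "mat_inverse (- C) = Some N" "N \<in> carrier_mat k k"
    "N * (- C) = 1\<^sub>m k"
proof -
  have mC: "- C \<in> carrier_mat k k" using C by simp
  have "Determinant.det C \<noteq> 0" using det_0_iff_vec_prod_zero_field[OF C] ker by blast
  moreover have "- C = (- 1) \<cdot>\<^sub>m C" using C by (intro eq_matI) auto
  ultimately have "Determinant.det (- C) \<noteq> 0" using C by (simp add: det_smult)
  then have "- C \<in> Units (ring_mat TYPE('a) k ())" by (rule det_non_zero_imp_unit[OF mC])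
  then obtain N where N: "mat_inverse (- C) = Some N"
    using mat_inverse(1)[OF mC, where b = "()"] by (cases "mat_inverse (- C)") auto
  then have NC: "- C * N = 1\<^sub>m k" "N * (- C) = 1\<^sub>m k" "N \<in> carrier_mat k k"
    using mat_inverse(2)[OF mC] by auto
  have "C * (- N) = 1\<^sub>m k" "(- N) * C = 1\<^sub>m k"
    using NC C by (simp_all add: uminus_mult_left_mat uminus_mult_right_mat)
  then have "invertible_mat C"
    unfolding invertible_mat_def inverts_mat_def using C NC(3) by (auto intro!: exI[of _ "- N"])
  then show thesis using that N NC by blast
qed

text \<open>The injectivity of \<open>C\<close> rests on solvability for the full vertex set, which turns a kernel vector
  into a solution, and on uniqueness for \<open>Vo\<close>, which makes this solution vanish. The matrix
  \<open>Y\<close> collects the inner vertex values of the solutions with unit data on \<open>Vo\<close>, and eliminating it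
  from \<open>B + C Y = 0\<close> produces the Schur complement.\<close>

lemma DtN_mat_schur_complement:
  assumes Vo: "Vo \<subseteq> verts G" and zo: "z \<notin> op_spectrum G (neg_op (Delta G Vo))"
    and zV: "z \<notin> op_spectrum G (neg_op (Delta G (verts G)))"
    and vn: "bij_betw v {..<n} (verts G)" and vm: "bij_betw v {..<m} Vo" and mn: "m < n"
  shows "\<exists>A\<in>carrier_mat m m. \<exists>B\<in>carrier_mat (n - m) m. \<exists>C\<in>carrier_mat (n - m) (n - m).
               - DtN_mat G (verts G) v z = four_block_mat A (transpose_mat B) B C \<and>
               invertible_mat C \<and>
               (\<exists>N. mat_inverse (- C) = Some N \<and>
                  - DtN_mat G Vo v z = A + transpose_mat B * N * B)"
proof -
  have cn: "card (verts G) = n" and cm: "card Vo = m"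
    using bij_betw_same_card[OF vn] bij_betw_same_card[OF vm] by auto
  have vV: "v k \<in> verts G" if "k < n" for k using that vn bij_betw_apply by fastforce
  have vVo: "v k \<in> Vo" if "k < m" for k using that vm bij_betw_apply by fastforce
  have vinj: "v k = v j \<longleftrightarrow> k = j" if "k < n" "j < n" for k j
    using that vn unfolding bij_betw_def inj_on_def by auto
  have vVi: "v (m + i) \<in> verts G - Vo" if "i < n - m" for i
  proof -
    have "v (m + i) \<notin> Vo"
    proof
      assume "v (m + i) \<in> Vo"
      then obtain j where "j < m" "v (m + i) = v j" using vm unfolding bij_betw_def by auto
      then show False using vinj[of "m + i" j] that by auto
    qed
    then show ?thesis using vV that by auto
  qed
  have Vi_v: "\<exists>i<n - m. w = v (m + i)" if "w \<in> verts G - Vo" for w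
  proof -
    have "w \<in> v ` {..<n}" using that vn unfolding bij_betw_def by simp
    then obtain k where k: "k < n" "w = v k" by auto
    then have "m \<le> k" using that vVo not_le_imp_less by blast
    then show ?thesis using k by (intro exI[of _ "k - m"]) auto
  qed
  define a where "a k j = DtN G (verts G) z (\<lambda>w. if w = v j then 1 else 0) (v k)" for k j
  have a_sym: "a k j = a j k" if "k < n" "j < n" for k j
    unfolding a_def using DtN_symmetric[OF zV vV vV] that by blast
  have expand: "normal_deriv G f (v k) =
      (\<Sum>j<m. a k j * y (v j)) + (\<Sum>i<n - m. a k (m + i) * y (v (m + i)))"
    if f: "helmholtz_graph G z f y" and k: "k < n" for f y k
  proof -
    have "normal_deriv G f (v k) = (\<Sum>j<n. a k j * y (v j))"
      unfolding normal_deriv_expansion[OF zV f vV[OF k]] a_def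
      by (rule sum.reindex_bij_betw[OF vn, symmetric])
    then show ?thesis using sum_lessThan_split[of m n "\<lambda>j. a k j * y (v j)"] mn by simp
  qed
  define A where "A = Matrix.mat m m (\<lambda>(k, j). - a k j)"
  define B where "B = Matrix.mat (n - m) m (\<lambda>(i, j). - a (m + i) j)"
  define C where "C = Matrix.mat (n - m) (n - m) (\<lambda>(i, j). - a (m + i) (m + j))"
  have carr: "A \<in> carrier_mat m m" "B \<in> carrier_mat (n - m) m" "C \<in> carrier_mat (n - m) (n - m)"
    unfolding A_def B_def C_def by auto
  have blocks: "- DtN_mat G (verts G) v z = four_block_mat A (transpose_mat B) B C"
  proof (rule eq_matI)
    fix k j assume "k < dim_row (four_block_mat A (transpose_mat B) B C)"
      "j < dim_col (four_block_mat A (transpose_mat B) B C)"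
    then have kj: "k < n" "j < n" using carr mn by auto
    have "(- DtN_mat G (verts G) v z) $$ (k, j) = - a k j"
      using kj by (simp add: DtN_mat_def cn a_def)
    also have "\<dots> = four_block_mat A (transpose_mat B) B C $$ (k, j)"
      using kj a_sym[of k j] by (auto simp: A_def B_def C_def)
    finally show "(- DtN_mat G (verts G) v z) $$ (k, j)
      = four_block_mat A (transpose_mat B) B C $$ (k, j)" .
  qed (use mn in \<open>auto simp: DtN_mat_def cn A_def C_def\<close>)
  have ker: "c = 0\<^sub>v (n - m)" if c: "c \<in> carrier_vec (n - m)" and Cc: "C *\<^sub>v c = 0\<^sub>v (n - m)" for c
  proof -
    \<comment> \<open>The solution whose vertex values are \<open>0\<close> on \<open>Vo\<close> and \<open>c\<close> on the inner vertices; \<open>C c = 0\<close> makes it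
      satisfy the Kirchhoff conditions, so it solves the homogeneous problem for \<open>Vo\<close>.\<close>
    define x where "x w = (if w \<in> Vo then 0 else vec_index c (inv_into {..<n} v w - m))" for w
    obtain f y where f: "helmholtz_graph G z f y" and y: "\<forall>w\<in>verts G. y w = x w"
      using helmholtz_graph_exists[OF subset_refl zV, of x] by blast
    have yo: "y w = 0" if "w \<in> Vo" for w using y that Vo unfolding x_def by auto
    have yi: "y (v (m + i)) = vec_index c i" if "i < n - m" for i
    proof -
      have "inv_into {..<n} v (v (m + i)) = m + i"
        using vn that unfolding bij_betw_def by (intro inv_into_f_f) auto
      then show ?thesis using y vVi[OF that] unfolding x_def by auto
    qed
    have "normal_deriv G f (v (m + i)) = 0" if i: "i < n - m" for i
    proof -
      have "normal_deriv G f (v (m + i)) = (\<Sum>j<n - m. a (m + i) (m + j) * vec_index c j)"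
        using expand[OF f, of "m + i"] i yo vVo yi by simp
      also have "\<dots> = - vec_index (C *\<^sub>v c) i"
        using i c by (simp add: C_def scalar_prod_def sum_negf atLeast0LessThan)
      finally show ?thesis using Cc i by simp
    qed
    then have "\<forall>w\<in>verts G - Vo. normal_deriv G f w = 0" using Vi_v by blast
    from helmholtz_graph_unique(2)[OF Vo zo f _ this] yo
    have "y w = 0" if "w \<in> verts G" for w using that by blast
    then show ?thesis using c yi vVi by (intro eq_vecI) auto
  qed
  obtain N where inv: "invertible_mat C" "mat_inverse (- C) = Some N"
    and N: "N \<in> carrier_mat (n - m) (n - m)" "N * (- C) = 1\<^sub>m (n - m)"
    using invertible_mat_of_trivial_kernel[OF carr(3) ker] by blast
  have "\<exists>g \<eta>. helmholtz_graph G z g \<eta> \<and> (\<forall>w\<in>Vo. \<eta> w = (if w = v j then 1 else 0)) \<and>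
      (\<forall>w\<in>verts G - Vo. normal_deriv G g w = 0)" for j
    by (rule helmholtz_graph_exists[OF Vo zo])
  then obtain \<phi> \<eta> where \<phi>: "\<And>j. helmholtz_graph G z (\<phi> j) (\<eta> j)"
    and \<eta>: "\<And>j. \<forall>w\<in>Vo. \<eta> j w = (if w = v j then 1 else 0)"
    and nd: "\<And>j. \<forall>w\<in>verts G - Vo. normal_deriv G (\<phi> j) w = 0" by metis
  define Y where "Y = Matrix.mat (n - m) m (\<lambda>(i, j). \<eta> j (v (m + i)))"
  have Y: "Y \<in> carrier_mat (n - m) m" unfolding Y_def by simp
  have nd_Y: "normal_deriv G (\<phi> j) (v k) = a k j + (\<Sum>i<n - m. a k (m + i) * Y $$ (i, j))"
    if "k < n" "j < m" for k j
  proof -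
    have "(\<Sum>l<m. a k l * \<eta> j (v l)) = (\<Sum>l<m. if l = j then a k l else 0)"
      using \<eta>[of j] vVo vinj that mn by (intro sum.cong) auto
    also have "\<dots> = a k j" using that by (simp add: sum.delta')
    finally show ?thesis using expand[OF \<phi>[of j] that(1)] that(2) by (simp add: Y_def)
  qed
  have "B = - C * Y"
  proof (rule eq_matI)
    fix i j assume "i < dim_row (- C * Y)" "j < dim_col (- C * Y)"
    then have ij: "i < n - m" "j < m" using carr Y by auto
    \<comment> \<open>Kirchhoff condition at the inner vertex \<open>v (m + i)\<close>\<close>
    have "0 = a (m + i) j + (\<Sum>l<n - m. a (m + i) (m + l) * Y $$ (l, j))"
      using nd_Y[of "m + i" j] ij nd vVi by simp
    also have "(\<Sum>l<n - m. a (m + i) (m + l) * Y $$ (l, j)) = (- C * Y) $$ (i, j)"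
      using ij Y by (simp add: C_def scalar_prod_def sum_negf atLeast0LessThan)
    finally have "(- C * Y) $$ (i, j) = - a (m + i) j" by (metis add_eq_0_iff)
    then show "B $$ (i, j) = (- C * Y) $$ (i, j)" using ij by (simp add: B_def)
  qed (use carr Y in auto)
  then have "N * B = N * (- C * Y)" by (rule arg_cong)
  also have "\<dots> = (N * (- C)) * Y"
    using N carr Y by (intro assoc_mult_mat[symmetric]) auto
  finally have NB: "N * B = Y" using N Y by simp
  have "- DtN_mat G Vo v z = A + transpose_mat B * Y"
  proof (rule eq_matI)
    fix k j assume "k < dim_row (A + transpose_mat B * Y)" "j < dim_col (A + transpose_mat B * Y)"
    then have kj: "k < m" "j < m" using carr Y by auto
    have "(- DtN_mat G Vo v z) $$ (k, j) = - normal_deriv G (\<phi> j) (v k)"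
      using kj DtN_eq_normal_deriv[OF Vo zo \<phi> \<eta> nd vVo] by (simp add: DtN_mat_def cm)
    also have "\<dots> = - a k j + (\<Sum>i<n - m. - a (m + i) k * Y $$ (i, j))"
      using nd_Y[of k j] kj mn a_sym[of k] by (simp add: sum_negf)
    also have "\<dots> = (A + transpose_mat B * Y) $$ (k, j)"
      using kj Y by (simp add: A_def B_def scalar_prod_def atLeast0LessThan)
    finally show "(- DtN_mat G Vo v z) $$ (k, j) = (A + transpose_mat B * Y) $$ (k, j)" .
  qed (use carr Y in \<open>auto simp: DtN_mat_def cm\<close>)
  then have "- DtN_mat G Vo v z = A + transpose_mat B * N * B"
    using NB N carr by (simp add: assoc_mult_mat[of _ m "n - m" N "n - m" B m])
  then show ?thesis using carr blocks inv by blast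
qed

end

theorem proposition1p2:
  fixes G :: "'v quantum_graph" and Vo :: "'v set" and z :: complex
  assumes "connected_quantum_graph G"
    and "Vo \<noteq> {}" and "Vo \<subseteq> verts G"
    and "z \<notin> op_spectrum G (neg_op (Delta G Vo))"
  shows "(\<forall>v. bij_betw v {..<card Vo} Vo \<longrightarrow>
            DtN_mat G Vo v z \<in> class_A (card Vo) v (reduced_edges G Vo)) \<and>
         (\<forall>v m n. bij_betw v {..<n} (verts G) \<and> bij_betw v {..<m} Vo \<and> m < n \<and>
            z \<notin> op_spectrum G (neg_op (Delta G (verts G))) \<longrightarrow>
            (\<exists>A\<in>carrier_mat m m. \<exists>B\<in>carrier_mat (n - m) m. \<exists>C\<in>carrier_mat (n - m) (n - m).
               - DtN_mat G (verts G) v z = four_block_mat A (transpose_mat B) B C \<and>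
               invertible_mat C \<and>
               (\<exists>N. mat_inverse (- C) = Some N \<and>
                  - DtN_mat G Vo v z = A + transpose_mat B * N * B)))"
proof -
  interpret connected_graph G by unfold_locales (fact assms(1))
  show ?thesis
    using DtN_mat_class_A[OF assms(3,4)] DtN_mat_schur_complement[OF assms(3,4)]
    by (intro conjI allI impI) blast+
qed

end
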